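(* Let $(X,d_\theta)$ be a complete $\theta$-metric space (with respect to a $B$-action $\theta$), let $\zeta$ be a simulation function, and let $T:X\to X$ be a $\mathcal{Z}$-contraction with respect to $\zeta$. Then $T$ has a unique fixed point $u$ in $X$, and for every $x_0\in X$ the Picard sequence $\{x_n\}$, defined by $x_n=Tx_{n-1}$ for $n\ge1$, converges to the fixed point $u$ of $T$.
   Context: A simulation function is a map $\zeta:[0,\infty)\times[0,\infty)\to\mathbb{R}$ such that: ($\zeta1$) $\zeta(0,0)=0$; ($\zeta2$) $\zeta(t,s)<s-t$ for all $s,t>0$; ($\zeta3$) if $\{t_n\},\{s_n\}$ are sequences in $(0,\infty)$ with $\lim_{n\to\infty}t_n=\lim_{n\to\infty}s_n>0$, then $\limsup_{n\to\infty}\zeta(t_n,s_n)<0$. The set of all simulation functions is denoted $\mathcal{Z}$. A $B$-action is a map $\theta:[0,\infty)\times[0,\infty)\to[0,\infty)$, continuous with respect to both variables, with image $\mathrm{Im}(\theta)=\{\theta(s,t):s\ge0,\,t\ge0\}$, such that: (B1) $\theta(0,0)=0$ and $\theta(s,t)=\theta(t,s)$ for all $s,t\ge0$; (B2) $\theta(s,t)<\theta(u,v)$ whenever either $s<u$ and $t\le v$, or $s\le u$ and $t<v$; (B3) for each $r\in\mathrm{Im}(\theta)$ and each $s\in[0,r]$ there exists $t\in[0,r]$ with $\theta(t,s)=r$; (B4) $\theta(s,0)\le s$ for all $s>0$. Let $X$ be a non-empty set. A $\theta$-metric on $X$ with respect to a $B$-action $\theta$ is a map $d_\theta:X\times X\to[0,\infty)$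 such that for all $x,y,z\in X$: ($\theta1$) $d_\theta(x,y)=0$ if and only if $x=y$; ($\theta2$) $d_\theta(x,y)=d_\theta(y,x)$; ($\theta3$) $d_\theta(x,y)\le\theta(d_\theta(x,z),d_\theta(z,y))$. The pair $(X,d_\theta)$ is then a $\theta$-metric space. A sequence $\{x_n\}$ in $X$ converges to $x\in X$ if $d_\theta(x_n,x)\to0$; it is Cauchy if $d_\theta(x_n,x_m)\to0$ as $n,m\to\infty$; $(X,d_\theta)$ is complete if every Cauchy sequence converges to a point of $X$. A self-map $T:X\to X$ is a $\mathcal{Z}$-contraction with respect to $\zeta\in\mathcal{Z}$ if $\zeta(d_\theta(Tx,Ty),d_\theta(x,y))\ge0$ for all $x,y\in X$. A fixed point of $T$ is a point $x\in X$ with $Tx=x$. *)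

theory Defs
  imports "HOL-Analysis.Analysis"
begin

text \<open>
  Functions on \<open>[0,\<infinity>) \<times> [0,\<infinity>)\<close> are modelled by total functions \<open>real \<Rightarrow> real \<Rightarrow> real\<close>; their
  values outside the nonnegative quadrant are never constrained and never used. The underlying
  set of a \<open>\<theta>\<close>-metric space is an explicit carrier \<open>X\<close>.
\<close>

text \<open>
  The upper limit below is taken in the extended reals, so that it may be \<open>-\<infinity>\<close> when the
  sequence is unbounded below.
\<close>

definition simulation_function :: "(real \<Rightarrow> real \<Rightarrow> real) \<Rightarrow> bool" where
  "simulation_function \<zeta> \<longleftrightarrow>
     \<zeta> 0 0 = 0 \<and>
     (\<forall>t s. 0 < t \<and> 0 < s \<longrightarrow> \<zeta> t s < s - t) \<and>
     (\<forall>(t :: nat \<Rightarrow> real) (s :: nat \<Rightarrow> real) L.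
        (\<forall>n. 0 < t n) \<and> (\<forall>n. 0 < s n) \<and> t \<longlonglongrightarrow> L \<and> s \<longlonglongrightarrow> L \<and> 0 < L \<longrightarrow>
        limsup (\<lambda>n. ereal (\<zeta> (t n) (s n))) < 0)"

definition action_image :: "(real \<Rightarrow> real \<Rightarrow> real) \<Rightarrow> real set" where
  "action_image \<theta> = {\<theta> s t |s t. 0 \<le> s \<and> 0 \<le> t}"

text \<open>
  Continuity is joint continuity on the closed quadrant. In the presence of strict
  monotonicity in each variable this coincides with separate continuity.
\<close>

definition B_action :: "(real \<Rightarrow> real \<Rightarrow> real) \<Rightarrow> bool" where
  "B_action \<theta> \<longleftrightarrow>
     (\<forall>s\<ge>0. \<forall>t\<ge>0. 0 \<le> \<theta> s t) \<and>
     continuous_on ({0..} \<times> {0..}) (\<lambda>(s, t). \<theta> s t) \<and>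
     \<theta> 0 0 = 0 \<and>
     (\<forall>s\<ge>0. \<forall>t\<ge>0. \<theta> s t = \<theta> t s) \<and>
     (\<forall>s\<ge>0. \<forall>t\<ge>0. \<forall>u\<ge>0. \<forall>v\<ge>0.
        (s < u \<and> t \<le> v) \<or> (s \<le> u \<and> t < v) \<longrightarrow> \<theta> s t < \<theta> u v) \<and>
     (\<forall>r\<in>action_image \<theta>. \<forall>s\<in>{0..r}. \<exists>t\<in>{0..r}. \<theta> t s = r) \<and>
     (\<forall>s>0. \<theta> s 0 \<le> s)"

definition theta_metric_space ::
    "'a set \<Rightarrow> (real \<Rightarrow> real \<Rightarrow> real) \<Rightarrow> ('a \<Rightarrow> 'a \<Rightarrow> real) \<Rightarrow> bool" where
  "theta_metric_space X \<theta> d \<longleftrightarrow>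
     X \<noteq> {} \<and> B_action \<theta> \<and>
     (\<forall>x\<in>X. \<forall>y\<in>X. 0 \<le> d x y) \<and>
     (\<forall>x\<in>X. \<forall>y\<in>X. d x y = 0 \<longleftrightarrow> x = y) \<and>
     (\<forall>x\<in>X. \<forall>y\<in>X. d x y = d y x) \<and>
     (\<forall>x\<in>X. \<forall>y\<in>X. \<forall>z\<in>X. d x y \<le> \<theta> (d x z) (d z y))"

definition theta_converges ::
    "'a set \<Rightarrow> ('a \<Rightarrow> 'a \<Rightarrow> real) \<Rightarrow> (nat \<Rightarrow> 'a) \<Rightarrow> 'a \<Rightarrow> bool" where
  "theta_converges X d x l \<longleftrightarrow>
     (\<forall>n. x n \<in> X) \<and> l \<in> X \<and> (\<lambda>n. d (x n) l) \<longlonglongrightarrow> 0"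

definition theta_Cauchy ::
    "'a set \<Rightarrow> ('a \<Rightarrow> 'a \<Rightarrow> real) \<Rightarrow> (nat \<Rightarrow> 'a) \<Rightarrow> bool" where
  "theta_Cauchy X d x \<longleftrightarrow>
     (\<forall>n. x n \<in> X) \<and>
     ((\<lambda>(n, m). d (x n) (x m)) \<longlongrightarrow> 0) (sequentially \<times>\<^sub>F sequentially)"

definition theta_complete :: "'a set \<Rightarrow> ('a \<Rightarrow> 'a \<Rightarrow> real) \<Rightarrow> bool" where
  "theta_complete X d \<longleftrightarrow>
     (\<forall>x. theta_Cauchy X d x \<longrightarrow> (\<exists>l\<in>X. theta_converges X d x l))"

definition Z_contraction ::
    "'a set \<Rightarrow> ('a \<Rightarrow> 'a \<Rightarrow> real) \<Rightarrow> (real \<Rightarrow> real \<Rightarrow> real) \<Rightarrow> ('a \<Rightarrow> 'a) \<Rightarrow> bool" where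
  "Z_contraction X d \<zeta> T \<longleftrightarrow>
     T \<in> X \<rightarrow> X \<and> (\<forall>x\<in>X. \<forall>y\<in>X. \<zeta> (d (T x) (T y)) (d x y) \<ge> 0)"

end

theory Submission
  imports Defs
begin

text \<open>
  A B-action satisfies \<open>\<theta> s 0 = s\<close>, so \<open>\<theta>\<close> behaves like addition when one argument tends to
  \<open>0\<close>. Along a Picard sequence the consecutive distances decrease, and their limit is \<open>0\<close>
  because a positive limit would contradict (\<open>\<zeta>3\<close>). If the sequence were not Cauchy, one could
  choose \<open>\<epsilon> > 0\<close>, arbitrarily late \<open>m\<close>, and the first \<open>n > m\<close> with
  \<open>d (x m) (x n) \<ge> \<epsilon>\<close>; then both \<open>d (x m) (x n)\<close> and \<open>d (x (m + 1)) (x (n + 1))\<close> tend to \<open>\<epsilon>\<close>,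
  contradicting (\<open>\<zeta>3\<close>) again. The limit is a fixed point because \<open>T\<close> does not increase distances.
\<close>

section \<open>B-actions and simulation functions\<close>

text \<open>By (B3) with second argument \<open>0\<close>, the value \<open>r = \<theta> s 0\<close>
  is also \<open>\<theta> t 0\<close> for some \<open>t\<close> in \<open>[0, r]\<close>. Then (B4)
  forces \<open>t = r\<close>, so \<open>\<theta> r 0 = \<theta> s 0\<close>, and strict
  monotonicity excludes \<open>r < s\<close>.\<close>

lemma B_action_zero_right:
  assumes B: "B_action \<theta>" and s: "0 \<le> s"
  shows "\<theta> s 0 = s"
proof -
  define r where "r = \<theta> s 0"
  have r0: "0 \<le> r" using B s by (auto simp: B_action_def r_def)
  have "\<theta> 0 0 = 0" using B by (simp add: B_action_def)
  moreover have "\<forall>s>0. \<theta> s 0 \<le> s" using B unfolding B_action_def by blast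
  ultimately have le: "\<theta> t 0 \<le> t" if "0 \<le> t" for t
    using that by (cases "t = 0") auto
  have "r \<in> action_image \<theta>" using s by (auto simp: action_image_def r_def)
  moreover have "\<forall>r\<in>action_image \<theta>. \<forall>s\<in>{0..r}. \<exists>t\<in>{0..r}. \<theta> t s = r"
    using B unfolding B_action_def by blast
  ultimately obtain t where t: "t \<in> {0..r}" "\<theta> t 0 = r"
    using r0 by (meson atLeastAtMost_iff order_refl)
  then have "t = r" using le[of t] by auto
  then have eq: "\<theta> r 0 = \<theta> s 0" using t r_def by simp
  have "\<forall>s\<ge>0. \<forall>t\<ge>0. \<forall>u\<ge>0. \<forall>v\<ge>0.
      (s < u \<and> t \<le> v) \<or> (s \<le> u \<and> t < v) \<longrightarrow> \<theta> s t < \<theta> u v"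
    using B unfolding B_action_def by blast
  then have "\<theta> r 0 < \<theta> s 0" if "r < s"
    using that r0 s by blast
  then have "r = s" using eq le[OF s] r_def by force
  then show ?thesis by (simp add: r_def)
qed

lemma B_action_zero_left:
  assumes "B_action \<theta>" "0 \<le> s"
  shows "\<theta> 0 s = s"
proof -
  have "\<theta> 0 s = \<theta> s 0" using assms by (simp add: B_action_def)
  then show ?thesis using B_action_zero_right[OF assms] by simp
qed

lemma B_action_nonneg:
  assumes "B_action \<theta>" "0 \<le> s" "0 \<le> t"
  shows "0 \<le> \<theta> s t"
  using assms by (simp add: B_action_def)

lemma B_action_mono:
  assumes "B_action \<theta>" "0 \<le> s" "0 \<le> t" "s \<le> u" "t \<le> v"
  shows "\<theta> s t \<le> \<theta> u v"
proof (cases "s = u \<and> t = v")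
  case False
  then have "(s < u \<and> t \<le> v) \<or> (s \<le> u \<and> t < v)" "0 \<le> u" "0 \<le> v" using assms by auto
  then have "\<theta> s t < \<theta> u v"
    using assms(1-3) unfolding B_action_def by blast
  then show ?thesis by simp
qed simp

text \<open>Continuity is given relative to the closed quadrant, hence the sign conditions on the
  functions and on their limits.\<close>

lemma B_action_tendsto:
  assumes B: "B_action \<theta>"
    and f: "(f \<longlongrightarrow> a) F" "\<And>n. 0 \<le> f n" and g: "(g \<longlongrightarrow> b) F" "\<And>n. 0 \<le> g n"
    and "0 \<le> a" "0 \<le> b"
  shows "((\<lambda>n. \<theta> (f n) (g n)) \<longlongrightarrow> \<theta> a b) F"
proof -
  have "continuous_on ({0..} \<times> {0..}) (\<lambda>(s, t). \<theta> s t)"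
    using B by (simp add: B_action_def)
  from continuous_on_tendsto_compose[OF this tendsto_Pair[OF f(1) g(1)]]
  show ?thesis using assms by simp
qed

text \<open>The form in which (\<zeta>3) is applied: since \<open>L > 0\<close>, both sequences are
  eventually positive, and dropping an initial segment makes (\<zeta>3) applicable, while
  nonnegative terms have nonnegative upper limit.\<close>

lemma simulation_function_no_positive_limit:
  assumes \<zeta>: "simulation_function \<zeta>"
    and t: "t \<longlonglongrightarrow> L" and s: "s \<longlonglongrightarrow> L" and L: "0 < L"
    and nonneg: "\<And>n::nat. 0 \<le> \<zeta> (t n) (s n)"
  shows False
proof -
  have "\<forall>\<^sub>F n in sequentially. 0 < t n \<and> 0 < s n"
    using order_tendstoD(1)[OF t L] order_tendstoD(1)[OF s L] by (rule eventually_conj)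
  then obtain N where N: "\<And>n. n \<ge> N \<Longrightarrow> 0 < t n \<and> 0 < s n"
    by (auto simp: eventually_sequentially)
  have "limsup (\<lambda>n. ereal (\<zeta> (t (n + N)) (s (n + N)))) < 0"
  proof -
    have "\<And>t s L. (\<forall>n. 0 < t n) \<and> (\<forall>n. 0 < s n) \<and> t \<longlonglongrightarrow> L \<and> s \<longlonglongrightarrow> L \<and> 0 < L \<Longrightarrow>
        limsup (\<lambda>n::nat. ereal (\<zeta> (t n) (s n))) < 0"
      using \<zeta> unfolding simulation_function_def by blast
    from this[of "\<lambda>n. t (n + N)" "\<lambda>n. s (n + N)" L] show ?thesis
      using N L LIMSEQ_ignore_initial_segment[OF t, of N] LIMSEQ_ignore_initial_segment[OF s, of N]
      by simp
  qed
  moreover have "0 \<le> limsup (\<lambda>n. ereal (\<zeta> (t (n + N)) (s (n + N))))"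
    by (rule le_Limsup) (auto simp: nonneg)
  ultimately show False by simp
qed

section \<open>Contractivity of the map and uniqueness of its fixed point\<close>

locale Z_contractive_map =
  fixes X :: "'a set"
    and \<theta> \<zeta> :: "real \<Rightarrow> real \<Rightarrow> real"
    and d :: "'a \<Rightarrow> 'a \<Rightarrow> real"
    and T :: "'a \<Rightarrow> 'a"
  assumes space: "theta_metric_space X \<theta> d"
    and sim: "simulation_function \<zeta>"
    and contr: "Z_contraction X d \<zeta> T"
begin

lemma action: "B_action \<theta>"
  using space by (simp add: theta_metric_space_def)

lemma nonneg: "x \<in> X \<Longrightarrow> y \<in> X \<Longrightarrow> 0 \<le> d x y"
  using space by (simp add: theta_metric_space_def)

lemma zero_iff: "x \<in> X \<Longrightarrow> y \<in> X \<Longrightarrow> d x y = 0 \<longleftrightarrow> x = y"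
  using space by (simp add: theta_metric_space_def)

lemma commute: "x \<in> X \<Longrightarrow> y \<in> X \<Longrightarrow> d x y = d y x"
  using space unfolding theta_metric_space_def by blast

lemma triangle: "x \<in> X \<Longrightarrow> y \<in> X \<Longrightarrow> z \<in> X \<Longrightarrow> d x y \<le> \<theta> (d x z) (d z y)"
  using space unfolding theta_metric_space_def by blast

lemma map_closed: "x \<in> X \<Longrightarrow> T x \<in> X"
  using contr by (auto simp: Z_contraction_def)

lemma zeta_nonneg: "x \<in> X \<Longrightarrow> y \<in> X \<Longrightarrow> 0 \<le> \<zeta> (d (T x) (T y)) (d x y)"
  using contr by (simp add: Z_contraction_def)

text \<open>(\<zeta>2) turns nonnegativity of \<open>\<zeta>\<close> into a strict decrease, but
  only when both distances are positive; coinciding images are therefore treated separately.\<close>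

lemma contractive:
  assumes "x \<in> X" "y \<in> X" "x \<noteq> y"
  shows "d (T x) (T y) < d x y"
proof (cases "T x = T y")
  case True
  then show ?thesis
    using assms nonneg[of x y] zero_iff[of x y] zero_iff[of "T x" "T y"] map_closed by fastforce
next
  case False
  then have "0 < d (T x) (T y)" "0 < d x y"
    using assms map_closed nonneg zero_iff by (metis order_le_less)+
  then have "\<zeta> (d (T x) (T y)) (d x y) < d x y - d (T x) (T y)"
    using sim by (simp add: simulation_function_def)
  then show ?thesis using zeta_nonneg[OF assms(1,2)] by simp
qed

lemma nonexpansive: "x \<in> X \<Longrightarrow> y \<in> X \<Longrightarrow> d (T x) (T y) \<le> d x y"
  using contractive[of x y] zero_iff[of x y] zero_iff[of "T x" "T y"] map_closed
  by (cases "x = y") auto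

lemma fixed_point_unique:
  assumes "u \<in> X" "v \<in> X" "T u = u" "T v = v"
  shows "v = u"
  using contractive[of v u] assms by force

section \<open>Picard sequences\<close>

context
  fixes x :: "nat \<Rightarrow> 'a"
  assumes x0: "x 0 \<in> X" and x_Suc: "\<And>n. x (Suc n) = T (x n)"
begin

lemma orbit_in: "x n \<in> X"
  by (induction n) (simp_all add: x0 x_Suc map_closed)

lemma orbit_asymptotically_regular: "(\<lambda>n. d (x n) (x (Suc n))) \<longlonglongrightarrow> 0"
proof -
  let ?a = "\<lambda>n. d (x n) (x (Suc n))"
  have "decseq ?a"
    by (rule decseq_SucI) (metis nonexpansive orbit_in x_Suc)
  then obtain L where L: "?a \<longlonglongrightarrow> L"
    using decseq_convergent[of ?a 0] nonneg[OF orbit_in orbit_in] by blast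
  have "0 \<le> L" using LIMSEQ_le_const[OF L, of 0] nonneg orbit_in by blast
  moreover have False if "0 < L"
  \<comment> \<open>(\<zeta>3) is applied to the sequence \<open>?a\<close> and its shift by one,
    which have the same limit.\<close>
  proof (rule simulation_function_no_positive_limit[OF sim LIMSEQ_Suc[OF L] L that])
    show "0 \<le> \<zeta> (?a (Suc n)) (?a n)" for n
      using zeta_nonneg[OF orbit_in orbit_in, of n "Suc n"] by (simp add: x_Suc)
  qed
  ultimately show ?thesis using L by (cases "L = 0") auto
qed

text \<open>The first index after \<open>m k\<close> at distance at least \<open>\<epsilon>\<close>
  is named \<open>Suc (n k)\<close>, so its predecessor is still closer than
  \<open>\<epsilon>\<close>. This makes the gap exceed \<open>\<epsilon>\<close> by no more than one
  vanishing step.\<close>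

lemma not_Cauchy_minimal_gap:
  assumes "\<not> theta_Cauchy X d x"
  obtains \<epsilon> m n where "0 < \<epsilon>"
    "\<And>k::nat. k \<le> m k" "\<And>k. m k \<le> n k"
    "\<And>k. \<epsilon> \<le> d (x (m k)) (x (Suc (n k)))" "\<And>k. d (x (m k)) (x (n k)) < \<epsilon>"
proof -
  have "\<not> ((\<lambda>(n, m). d (x n) (x m)) \<longlongrightarrow> 0) (sequentially \<times>\<^sub>F sequentially)"
    using assms orbit_in by (simp add: theta_Cauchy_def)
  then obtain \<epsilon> where \<epsilon>: "0 < \<epsilon>"
    and ne: "\<not> (\<forall>\<^sub>F p in sequentially \<times>\<^sub>F sequentially. dist (case p of (n, m) \<Rightarrow> d (x n) (x m)) 0 < \<epsilon>)"
    unfolding tendsto_iff by blast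
  have ex: "\<exists>m n. k \<le> m \<and> m \<le> n \<and> \<epsilon> \<le> d (x m) (x (Suc n)) \<and> d (x m) (x n) < \<epsilon>" for k
  proof -
    from ne obtain i j where ij: "k \<le> i" "k \<le> j" "\<not> \<bar>d (x i) (x j)\<bar> < \<epsilon>"
      unfolding eventually_prod_sequentially by fastforce
    then have far: "\<epsilon> \<le> d (x i) (x j)" using nonneg[OF orbit_in orbit_in, of i j] by simp
    \<comment> \<open>Symmetry allows the two indices to be ordered, so that the search can start at
      the smaller one.\<close>
    then have "\<epsilon> \<le> d (x (min i j)) (x (max i j))"
      using commute[OF orbit_in orbit_in, of i j] by (simp add: min_def max_def)
    moreover define m where "m = min i j"
    ultimately have far': "\<exists>q. m \<le> q \<and> \<epsilon> \<le> d (x m) (x q)" by (metis max.cobounded1 min.coboundedI1)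
    define q where "q = (LEAST q. m \<le> q \<and> \<epsilon> \<le> d (x m) (x q))"
    have q: "m \<le> q" "\<epsilon> \<le> d (x m) (x q)" using LeastI_ex[OF far'] by (auto simp: q_def)
    have "d (x m) (x m) = 0" using zero_iff orbit_in by blast
    then have "q \<noteq> m" using q \<epsilon> by auto
    then obtain n where n: "q = Suc n" "m \<le> n" using q(1) by (cases q) auto
    have "\<not> (m \<le> n \<and> \<epsilon> \<le> d (x m) (x n))"
      using not_less_Least[of n "\<lambda>q. m \<le> q \<and> \<epsilon> \<le> d (x m) (x q)"] n(1) q_def by simp
    moreover have "k \<le> m" using ij by (simp add: m_def)
    ultimately show ?thesis using q n by (metis linorder_not_le)
  qed
  then show thesis using that[OF \<epsilon>] by metis
qed

lemma orbit_Cauchy: "theta_Cauchy X d x"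
proof (rule ccontr)
  assume "\<not> theta_Cauchy X d x"
  then obtain \<epsilon> m n where \<epsilon>: "0 < \<epsilon>" and km: "\<And>k::nat. k \<le> m k" and mn: "\<And>k. m k \<le> n k"
    and ge: "\<And>k. \<epsilon> \<le> d (x (m k)) (x (Suc (n k)))" and lt: "\<And>k. d (x (m k)) (x (n k)) < \<epsilon>"
    using not_Cauchy_minimal_gap by blast
  define a where "a = (\<lambda>n. d (x n) (x (Suc n)))"
  have a_nonneg: "0 \<le> a n" for n by (simp add: a_def nonneg orbit_in)
  \<comment> \<open>Tending to infinity is enough for reindexing; \<open>f\<close> need not be
    monotone.\<close>
  have a0: "(\<lambda>k. a (f k)) \<longlonglongrightarrow> 0" if "\<And>k. k \<le> f k" for f
  proof -
    have "filterlim f at_top sequentially"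
      using that by (auto intro: filterlim_at_top_mono[OF filterlim_ident])
    then show ?thesis
      using filterlim_compose orbit_asymptotically_regular unfolding a_def by fast
  qed
  have kn: "k \<le> n k" for k using km mn le_trans by blast
  define s where "s = (\<lambda>k. d (x (m k)) (x (Suc (n k))))"
  define t where "t = (\<lambda>k. d (x (Suc (m k))) (x (Suc (Suc (n k)))))"
  have s_le: "s k \<le> \<theta> \<epsilon> (a (n k))" for k
  proof -
    have "s k \<le> \<theta> (d (x (m k)) (x (n k))) (a (n k))"
      unfolding s_def a_def by (intro triangle orbit_in)
    also have "\<dots> \<le> \<theta> \<epsilon> (a (n k))"
      using lt[of k] by (intro B_action_mono[OF action] nonneg orbit_in a_nonneg) auto
    finally show ?thesis .
  qed
  have "(\<lambda>k. \<theta> \<epsilon> (a (n k))) \<longlonglongrightarrow> \<theta> \<epsilon> 0"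
    using \<epsilon> a_nonneg kn by (intro B_action_tendsto[OF action] a0) auto
  then have up: "(\<lambda>k. \<theta> \<epsilon> (a (n k))) \<longlonglongrightarrow> \<epsilon>"
    using B_action_zero_right[OF action, of \<epsilon>] \<epsilon> by simp
  have s_lim: "s \<longlonglongrightarrow> \<epsilon>"
    by (rule tendsto_sandwich[OF _ _ tendsto_const up]) (use ge s_le in \<open>auto simp: s_def\<close>)
  have t_nonneg: "0 \<le> t k" for k by (simp add: t_def nonneg orbit_in)
  have t_le: "t k \<le> s k" for k
    unfolding s_def t_def using nonexpansive[OF orbit_in orbit_in] by (metis x_Suc)
  \<comment> \<open>The detour runs from \<open>x (m k)\<close> to its successor, on to
    \<open>x (Suc (Suc (n k)))\<close>, and one step back to \<open>x (Suc (n k))\<close>.\<close>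
  have s_le_t: "s k \<le> \<theta> (a (m k)) (\<theta> (t k) (a (Suc (n k))))" for k
  proof -
    have "d (x (Suc (m k))) (x (Suc (n k))) \<le> \<theta> (t k) (a (Suc (n k)))"
      using triangle[OF orbit_in orbit_in orbit_in, of "Suc (m k)" "Suc (n k)" "Suc (Suc (n k))"]
        commute[OF orbit_in orbit_in, of "Suc (Suc (n k))" "Suc (n k)"]
      by (simp add: t_def a_def)
    then have "\<theta> (a (m k)) (d (x (Suc (m k))) (x (Suc (n k))))
        \<le> \<theta> (a (m k)) (\<theta> (t k) (a (Suc (n k))))"
      by (intro B_action_mono[OF action] a_nonneg nonneg orbit_in) auto
    then show ?thesis
      using triangle[OF orbit_in orbit_in orbit_in, of "m k" "Suc (n k)" "Suc (m k)"]
      by (simp add: s_def a_def)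
  qed
  \<comment> \<open>The bound \<open>s_le_t\<close> cannot be solved for \<open>t k\<close> by
    subtraction. Instead, \<open>t k \<le> c\<close> would bound \<open>s k\<close> by a quantity
    tending to \<open>c < \<epsilon>\<close>, which eventually contradicts
    \<open>ge\<close>.\<close>
  have t_gt: "\<forall>\<^sub>F k in sequentially. c < t k" if c: "0 \<le> c" "c < \<epsilon>" for c
  proof -
    have "(\<lambda>k. \<theta> (a (m k)) (\<theta> c (a (Suc (n k))))) \<longlonglongrightarrow> \<theta> 0 (\<theta> c 0)"
      using c a_nonneg km kn B_action_nonneg[OF action]
      by (intro B_action_tendsto[OF action] a0) (auto intro: le_SucI)
    moreover have "\<theta> 0 (\<theta> c 0) = c"
      using c by (simp add: B_action_zero_left[OF action] B_action_zero_right[OF action])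
    ultimately have "\<forall>\<^sub>F k in sequentially. \<theta> (a (m k)) (\<theta> c (a (Suc (n k)))) < \<epsilon>"
      using c(2) by (auto dest: order_tendstoD(2))
    then show ?thesis
    proof (rule eventually_mono)
      fix k assume less: "\<theta> (a (m k)) (\<theta> c (a (Suc (n k)))) < \<epsilon>"
      show "c < t k"
      proof (rule ccontr)
        assume "\<not> c < t k"
        then have "\<theta> (a (m k)) (\<theta> (t k) (a (Suc (n k)))) \<le> \<theta> (a (m k)) (\<theta> c (a (Suc (n k))))"
          by (intro B_action_mono[OF action] B_action_nonneg[OF action] a_nonneg t_nonneg) auto
        then show False using less s_le_t[of k] ge[of k] by (simp add: s_def)
      qed
    qed
  qed
  have t_lim: "t \<longlonglongrightarrow> \<epsilon>"
  proof (rule order_tendstoI)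
    fix c assume "c < \<epsilon>"
    then show "\<forall>\<^sub>F k in sequentially. c < t k"
      \<comment> \<open>A negative \<open>c\<close> is replaced by \<open>0\<close>, because
        \<open>t_gt\<close> concerns arguments of \<open>\<theta>\<close> in the quadrant.\<close>
      using t_gt[of "max c 0"] \<epsilon> by (auto elim: eventually_mono)
  next
    fix c assume "\<epsilon> < c"
    from order_tendstoD(2)[OF s_lim this] show "\<forall>\<^sub>F k in sequentially. t k < c"
      by (rule eventually_mono) (use t_le in \<open>metis le_less_trans\<close>)
  qed
  show False
  proof (rule simulation_function_no_positive_limit[OF sim t_lim s_lim \<epsilon>])
    show "0 \<le> \<zeta> (t k) (s k)" for k
      using zeta_nonneg[OF orbit_in orbit_in, of "m k" "Suc (n k)"] by (simp add: s_def t_def x_Suc)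
  qed
qed

text \<open>The triangle inequality through \<open>x (Suc n)\<close> bounds \<open>d l (T l)\<close>
  by \<open>\<theta>\<close> of two vanishing distances, the second being at most
  \<open>d (x n) l\<close>. Continuity of \<open>\<theta>\<close> at the origin then gives
  \<open>0\<close>.\<close>

lemma orbit_limit_fixed:
  assumes "theta_converges X d x l"
  shows "T l = l"
proof -
  have l: "l \<in> X" and lim: "(\<lambda>n. d (x n) l) \<longlonglongrightarrow> 0"
    using assms by (auto simp: theta_converges_def)
  have lim': "(\<lambda>n. d l (x (Suc n))) \<longlonglongrightarrow> 0"
    using LIMSEQ_Suc[OF lim] commute[OF l orbit_in] by simp
  have Tlim: "(\<lambda>n. d (x (Suc n)) (T l)) \<longlonglongrightarrow> 0"
  proof (rule tendsto_sandwich[OF _ _ tendsto_const lim])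
    show "\<forall>\<^sub>F n in sequentially. 0 \<le> d (x (Suc n)) (T l)"
      using nonneg orbit_in map_closed l by simp
    show "\<forall>\<^sub>F n in sequentially. d (x (Suc n)) (T l) \<le> d (x n) l"
      using nonexpansive orbit_in l by (simp add: x_Suc)
  qed
  have "(\<lambda>n. \<theta> (d l (x (Suc n))) (d (x (Suc n)) (T l))) \<longlonglongrightarrow> \<theta> 0 0"
    using nonneg orbit_in map_closed l
    by (intro B_action_tendsto[OF action lim' _ Tlim]) auto
  then have "d l (T l) \<le> \<theta> 0 0"
    by (rule LIMSEQ_le_const) (use triangle orbit_in map_closed l in blast)
  then have "d l (T l) = 0"
    using nonneg[OF l map_closed[OF l]] B_action_zero_right[OF action, of 0] by simp
  then show ?thesis using zero_iff[OF l map_closed[OF l]] by simp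
qed

end

section \<open>Existence of the fixed point and convergence to it\<close>

lemma Picard_converges:
  assumes complete: "theta_complete X d" and x: "x 0 \<in> X" "\<And>n. x (Suc n) = T (x n)"
  obtains l where "l \<in> X" "T l = l" "theta_converges X d x l"
  using complete orbit_Cauchy[of x, OF x] orbit_limit_fixed[of x, OF x]
  unfolding theta_complete_def by blast

end

theorem theorem3p3:
  fixes X :: "'a set"
    and \<theta> \<zeta> :: "real \<Rightarrow> real \<Rightarrow> real"
    and d :: "'a \<Rightarrow> 'a \<Rightarrow> real"
    and T :: "'a \<Rightarrow> 'a"
  assumes "theta_metric_space X \<theta> d"
    and "theta_complete X d"
    and "simulation_function \<zeta>"
    and "Z_contraction X d \<zeta> T"
  shows "\<exists>u. u \<in> X \<and> T u = u \<and>
           (\<forall>v\<in>X. T v = v \<longrightarrow> v = u) \<and>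
           (\<forall>x :: nat \<Rightarrow> 'a. x 0 \<in> X \<and> (\<forall>n\<ge>1. x n = T (x (n - 1))) \<longrightarrow>
              theta_converges X d x u)"
proof -
  interpret Z_contractive_map X \<theta> \<zeta> d T
    using assms by unfold_locales
  obtain p where p: "p \<in> X"
    using assms(1) by (auto simp: theta_metric_space_def)
  \<comment> \<open>The iterates of one arbitrary point produce \<open>u\<close>; the limit of any
    other Picard sequence is also fixed and hence equals \<open>u\<close> by uniqueness.\<close>
  obtain u where u: "u \<in> X" "T u = u"
    using Picard_converges[OF assms(2), of "\<lambda>n. (T ^^ n) p"] p by auto
  have "theta_converges X d x u"
    if x: "x 0 \<in> X" "\<forall>n\<ge>1. x n = T (x (n - 1))" for x :: "nat \<Rightarrow> 'a"
  proof -
    have "x (Suc n) = T (x n)" for n using x(2) by simp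
    then obtain l where "l \<in> X" "T l = l" "theta_converges X d x l"
      using Picard_converges[of x, OF assms(2) x(1)] by blast
    then show ?thesis using fixed_point_unique u by blast
  qed
  then show ?thesis using u fixed_point_unique by blast
qed

end
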